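(* Let $f:\mathcal H\to\mathcal H$ be continuous and satisfy, for some $\ell\in\mathbb R$, the one-sided Lipschitz condition $\mathrm{Re}\,\langle v-w,f(v)-f(w)\rangle_{\mathcal H}\le \ell\,\|v-w\|_{\mathcal H}^2$ for all $v,w\in\mathcal H$. Let $y$ be a solution of $\dot y=f(y)$ with initial value $y(0)$, and let $u(t)=\Phi(\theta(t))$ be the regularized dynamical parametric approximation with defect size $\delta(t)$. Then, for all $t$ in the considered time interval $[0,\bar t]$, $$\|u(t)-y(t)\|_{\mathcal H}\le e^{\ell t}\,\|u(0)-y(0)\|_{\mathcal H}+\int_0^t e^{\ell(t-s)}\,\delta(s)\,ds .$$
   Context: $\mathcal H$ is a (real or complex, finite- or infinite-dimensional) Hilbert space (state space); the real part is only relevant in the complex case. $\mathcal Q$ is a finite-dimensional inner product space (parameter space). $\Phi:\mathcal Q\to\mathcal H$ is twice continuously (Fréchet) differentiable; it need not be injective, and $\Phi'(\theta)$ may have arbitrarily small singular values and varying rank. $\varepsilon(t)>0$ is a (continuous) regularization parameter function on $[0,\bar t]$. Regularized dynamical parametric approximation: $u(t)=\Phi(\theta(t))$, where $\theta:[0,\bar t]\to\mathcal Q$ is continuously differentiable and for every $t$ the derivative $\dot\theta(t)\in\mathcal Q$ (and $\dot u(t)=\Phi'(\theta(t))\dot\theta(t)$) is the unique minimizer in the regularized linear least squares problem $$\delta(t)^2:=\|\Phi'(\theta(t))\dot\theta(t)-f(u(t))\|_{\mathcal H}^2+\varepsilon(t)^2\|\dot\theta(t)\|_{\mathcal Q}^2\quad\text{is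 minimal.}$$ The defect size $\delta(t)\ge0$ is the square root of this minimal value. *)

theory Defs
  imports "HOL-Analysis.Analysis"
begin

text \<open>
  The sort \<open>{real_normed_field, real_inner}\<close> is used for the scalars: it contains \<open>real\<close> and
  \<open>complex\<close> (and, by the Gelfand--Mazur theorem, nothing else up to isomorphism).  Real part and
  conjugate are recovered from the inner product of the scalar field.
\<close>

definition scalar_Re :: "'k::{real_normed_field, real_inner} \<Rightarrow> real"
  where "scalar_Re z = z \<bullet> 1"

definition scalar_cnj :: "'k::{real_normed_field, real_inner} \<Rightarrow> 'k"
  where "scalar_cnj z = of_real (2 * scalar_Re z) - z"

lemma scalar_Re_real: "scalar_Re (x::real) = x"
  and scalar_cnj_real: "scalar_cnj (x::real) = x"
  and scalar_Re_complex: "scalar_Re z = Re z"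
  and scalar_cnj_complex: "scalar_cnj z = cnj z"
  by (simp_all add: scalar_Re_def scalar_cnj_def inner_complex_def complex_eq_iff)

text \<open>
  The norm, topology and real scalar multiplication come from the type class; the locale says that
  they are induced by the inner product \<open>ip\<close> over the scalar field \<open>'k\<close>.  The inner product is
  linear in its second argument; its real part, the only thing used below, does not depend on this
  convention.
\<close>

locale inner_product_space = vector_space scale
  for scale :: "'k::{real_normed_field, real_inner} \<Rightarrow> 'a::real_normed_vector \<Rightarrow> 'a" +
  fixes ip :: "'a \<Rightarrow> 'a \<Rightarrow> 'k"
  assumes scale_of_real: "scale (of_real r) x = r *\<^sub>R x"
    and ip_add_right: "ip x (y + z) = ip x y + ip x z"
    and ip_scale_right: "ip x (scale c y) = c * ip x y"
    and ip_cnj: "ip y x = scalar_cnj (ip x y)"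
    and ip_norm: "ip x x = of_real ((norm x)\<^sup>2)"

locale hilbert_space = inner_product_space scale ip
  for scale :: "'k::{real_normed_field, real_inner} \<Rightarrow> 'a::banach \<Rightarrow> 'a" and ip

locale fin_dim_inner_product_space = inner_product_space +
  assumes fin_dim: "\<exists>B. finite B \<and> span B = UNIV"

lemma hilbert_space_real:
  "hilbert_space scaleR (inner :: 'a::{real_inner, banach} \<Rightarrow> 'a \<Rightarrow> real)"
  by unfold_locales
    (simp_all add: inner_add_right inner_commute scalar_cnj_real power2_norm_eq_inner algebra_simps)

lemma hilbert_space_complex: "hilbert_space (*) (\<lambda>x y. cnj x * y)"
  by unfold_locales
    (simp_all add: scalar_cnj_complex scaleR_conv_of_real complex_norm_square algebra_simps
      del: of_real_power)

text \<open>
  Derivatives are Frechet derivatives over the reals, also for complex spaces: this allows real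
  parameters for a complex state space, and a complex Frechet derivative is in particular a real one.
\<close>

definition twice_continuously_differentiable ::
    "('q::real_normed_vector \<Rightarrow> 'h::real_normed_vector) \<Rightarrow> bool"
  where "twice_continuously_differentiable \<Phi> \<longleftrightarrow>
    (\<exists>(\<Phi>' :: 'q \<Rightarrow> 'q \<Rightarrow>\<^sub>L 'h) (\<Phi>'' :: 'q \<Rightarrow> 'q \<Rightarrow>\<^sub>L ('q \<Rightarrow>\<^sub>L 'h)).
      (\<forall>q. (\<Phi> has_derivative blinfun_apply (\<Phi>' q)) (at q)) \<and>
      (\<forall>q. (\<Phi>' has_derivative blinfun_apply (\<Phi>'' q)) (at q)) \<and>
      continuous_on UNIV \<Phi>'')"

definition least_squares_functional ::
    "('q::real_normed_vector \<Rightarrow> 'h::real_normed_vector) \<Rightarrow> ('h \<Rightarrow> 'h) \<Rightarrow> real \<Rightarrow> 'q \<Rightarrow> 'q \<Rightarrow> real"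
  where "least_squares_functional \<Phi> f \<epsilon> q v =
    (norm (frechet_derivative \<Phi> (at q) v - f (\<Phi> q)))\<^sup>2 + \<epsilon>\<^sup>2 * (norm v)\<^sup>2"

definition is_unique_minimizer :: "('q \<Rightarrow> real) \<Rightarrow> 'q \<Rightarrow> bool"
  where "is_unique_minimizer J v \<longleftrightarrow>
    is_arg_min J (\<lambda>_. True) v \<and> (\<forall>w. is_arg_min J (\<lambda>_. True) w \<longrightarrow> w = v)"

text \<open>\<open>\<theta>'\<close> is the time derivative of \<open>\<theta>\<close> (one-sided at the endpoints of the interval).\<close>

definition regularized_parametric_approximation ::
    "('q::real_normed_vector \<Rightarrow> 'h::real_normed_vector) \<Rightarrow> ('h \<Rightarrow> 'h) \<Rightarrow> (real \<Rightarrow> real) \<Rightarrow> real \<Rightarrow>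
      (real \<Rightarrow> 'q) \<Rightarrow> (real \<Rightarrow> 'q) \<Rightarrow> (real \<Rightarrow> 'h) \<Rightarrow> bool"
  where "regularized_parametric_approximation \<Phi> f \<epsilon> T \<theta> \<theta>' u \<longleftrightarrow>
    continuous_on {0..T} \<theta>' \<and>
    (\<forall>t\<in>{0..T}.
      (\<theta> has_vector_derivative \<theta>' t) (at t within {0..T}) \<and>
      is_unique_minimizer (least_squares_functional \<Phi> f (\<epsilon> t) (\<theta> t)) (\<theta>' t) \<and>
      u t = \<Phi> (\<theta> t))"

definition defect_size ::
    "('q::real_normed_vector \<Rightarrow> 'h::real_normed_vector) \<Rightarrow> ('h \<Rightarrow> 'h) \<Rightarrow> (real \<Rightarrow> real) \<Rightarrow>
      (real \<Rightarrow> 'q) \<Rightarrow> (real \<Rightarrow> 'q) \<Rightarrow> real \<Rightarrow> real"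
  where "defect_size \<Phi> f \<epsilon> \<theta> \<theta>' t =
    sqrt (least_squares_functional \<Phi> f (\<epsilon> t) (\<theta> t) (\<theta>' t))"

end

theory Submission
  imports Defs
begin

text \<open>
  The error \<open>e = u - y\<close> satisfies \<open>e' = f u - f y + d\<close> with a defect \<open>d\<close> whose norm is at most
  \<open>\<delta>\<close>, so the one-sided Lipschitz condition bounds the derivative of \<open>\<parallel>exp (- l t) e\<parallel>\<^sup>2\<close> by
  \<open>2 \<parallel>exp (- l t) e\<parallel> exp (- l t) \<delta>\<close>.  As the norm need not be differentiable where \<open>e\<close> vanishes, it
  is replaced by \<open>sqrt (\<parallel>exp (- l t) e\<parallel>\<^sup>2 + \<eta>\<^sup>2)\<close>, whose derivative is at most \<open>exp (- l t) \<delta>\<close> for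
  every \<open>\<eta> > 0\<close>; integrate and let \<open>\<eta>\<close> tend to \<open>0\<close>.
\<close>

text \<open>In an abstract scalar field, \<open>1 \<bullet> 1 = 1\<close> has to come from
  \<open>norm_one\<close>; pairing a real multiple of one with one then returns the factor.\<close>

lemma scalar_Re_of_real [simp]:
  "scalar_Re (of_real r :: 'k::{real_normed_field, real_inner}) = r"
proof -
  have "(1::'k) \<bullet> 1 = 1"
    by (metis norm_one power2_norm_eq_inner power_one)
  then show ?thesis
    by (simp add: scalar_Re_def of_real_def)
qed

lemma scalar_Re_cnj [simp]: "scalar_Re (scalar_cnj z) = scalar_Re z"
proof -
  have "scalar_Re (scalar_cnj z) = scalar_Re (of_real (2 * scalar_Re z) :: 'a) - scalar_Re z"
    unfolding scalar_cnj_def by (simp add: scalar_Re_def inner_diff_left)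
  then show ?thesis
    by (simp only: scalar_Re_of_real)
qed

lemma scalar_Re_of_real_mult [simp]: "scalar_Re (of_real r * z) = r * scalar_Re z"
  by (simp add: scalar_Re_def scaleR_conv_of_real [symmetric])

context inner_product_space
begin

text \<open>The real inner product underlying \<open>ip\<close>. The type is only a normed space, so
  symmetry, bilinearity and Cauchy-Schwarz are derived from the locale axioms, uniformly in the
  scalar field.\<close>

definition re_ip :: "'a \<Rightarrow> 'a \<Rightarrow> real"
  where "re_ip x y = scalar_Re (ip x y)"

lemma re_ip_commute: "re_ip y x = re_ip x y"
  unfolding re_ip_def by (subst ip_cnj) simp

lemma re_ip_add_right: "re_ip x (y + z) = re_ip x y + re_ip x z"
  by (simp add: re_ip_def ip_add_right scalar_Re_def inner_add_left)

lemma re_ip_add_left: "re_ip (x + y) z = re_ip x z + re_ip y z"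
  by (metis re_ip_add_right re_ip_commute)

lemma re_ip_scaleR_right: "re_ip x (r *\<^sub>R y) = r * re_ip x y"
  by (simp add: re_ip_def scale_of_real [symmetric] ip_scale_right)

lemma re_ip_scaleR_left: "re_ip (r *\<^sub>R x) y = r * re_ip x y"
  by (metis re_ip_scaleR_right re_ip_commute)

lemma re_ip_self: "re_ip x x = (norm x)\<^sup>2"
  by (simp only: re_ip_def ip_norm scalar_Re_of_real)

lemma re_ip_Cauchy_Schwarz: "\<bar>re_ip x y\<bar> \<le> norm x * norm y"
proof (cases "y = 0")
  case True
  then show ?thesis
    using re_ip_scaleR_right [of x 0 0] by simp
next
  case False
  \<comment> \<open>This \<open>r\<close> minimizes the norm of \<open>x + r *\<^sub>R y\<close>: it
    subtracts from \<open>x\<close> its orthogonal projection onto \<open>y\<close>.\<close>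
  define r where "r = - re_ip x y / (norm y)\<^sup>2"
  have "0 \<le> re_ip (x + r *\<^sub>R y) (x + r *\<^sub>R y)"
    by (simp add: re_ip_self)
  also have "\<dots> = (norm x)\<^sup>2 + 2 * r * re_ip x y + r\<^sup>2 * (norm y)\<^sup>2"
    by (simp add: re_ip_add_left re_ip_add_right re_ip_scaleR_left re_ip_scaleR_right
        re_ip_self [of x] re_ip_self [of y] re_ip_commute [of y x] power2_eq_square distrib_left)
  also have "\<dots> = (norm x)\<^sup>2 - (re_ip x y)\<^sup>2 / (norm y)\<^sup>2"
    using False by (simp add: r_def field_simps power2_eq_square)
  finally have "(re_ip x y)\<^sup>2 \<le> (norm x * norm y)\<^sup>2"
    using False by (simp add: field_simps)
  then show ?thesis
    by (metis abs_le_square_iff abs_mult abs_norm_cancel)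
qed

text \<open>Gives access to the product rule, by which the squared norm is differentiated.\<close>

lemma bounded_bilinear_re_ip: "bounded_bilinear re_ip"
proof
  show "\<exists>K. \<forall>a b. norm (re_ip a b) \<le> norm a * norm b * K"
    by (rule exI [of _ 1]) (simp add: re_ip_Cauchy_Schwarz)
qed (simp_all add: re_ip_add_left re_ip_add_right re_ip_scaleR_left re_ip_scaleR_right)

lemma has_field_derivative_norm_squared:
  assumes "(e has_vector_derivative e') (at t within S)"
  shows "((\<lambda>t. (norm (e t))\<^sup>2) has_field_derivative 2 * re_ip (e t) e') (at t within S)"
proof -
  have "((\<lambda>t. re_ip (e t) (e t)) has_vector_derivative re_ip (e t) e' + re_ip e' (e t))
      (at t within S)"
    by (rule bounded_bilinear.has_vector_derivative [OF bounded_bilinear_re_ip assms assms])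
  then show ?thesis
    by (simp add: re_ip_self re_ip_commute [of e'] has_real_derivative_iff_has_vector_derivative)
qed

text \<open>Hypothesis \<open>le\<close> is the differential inequality for the norm, with
  right-hand side \<open>l * norm (e t) + \<delta> t\<close>, multiplied by
  \<open>norm (e t)\<close>. In this form it makes sense at zeros of \<open>e\<close> too.\<close>

lemma norm_gronwall:
  fixes e e' :: "real \<Rightarrow> 'a" and \<delta> :: "real \<Rightarrow> real"
  assumes deriv: "\<And>t. t \<in> {0..T} \<Longrightarrow> (e has_vector_derivative e' t) (at t within {0..T})"
    and le: "\<And>t. t \<in> {0..T} \<Longrightarrow> re_ip (e t) (e' t) \<le> l * (norm (e t))\<^sup>2 + norm (e t) * \<delta> t"
    and \<delta>: "continuous_on {0..T} \<delta>" "\<And>t. t \<in> {0..T} \<Longrightarrow> 0 \<le> \<delta> t"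
    and t: "t \<in> {0..T}"
  shows "norm (e t) \<le> exp (l * t) * norm (e 0) + integral {0..t} (\<lambda>s. exp (l * (t - s)) * \<delta> s)"
proof -
  define I where "I t = integral {0..t} (\<lambda>s. exp (- l * s) * \<delta> s)" for t
  have bound: "exp (- l * t) * norm (e t) \<le> norm (e 0) + I t + \<eta>" if "\<eta> > 0" for \<eta>
  proof -
    define N where "N s = (exp (- l * s) * norm (e s))\<^sup>2 + \<eta>\<^sup>2" for s
    have N_pos: "N s > 0" for s
      using that by (simp add: N_def add_nonneg_pos)
    \<comment> \<open>In this form the norm occurs only squared, hence differentiably even where
      \<open>e\<close> vanishes.\<close>
    have N_eq: "N = (\<lambda>s. exp (- 2 * l * s) * (norm (e s))\<^sup>2 + \<eta>\<^sup>2)"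
      by (simp add: fun_eq_iff N_def power_mult_distrib mult.assoc flip: exp_double)
    define N' where
      "N' s = 2 * exp (- 2 * l * s) * (re_ip (e s) (e' s) - l * (norm (e s))\<^sup>2)" for s
    have N_deriv: "(N has_field_derivative N' s) (at s within {0..T})" if "s \<in> {0..T}" for s
      unfolding N_eq N'_def
      by (rule derivative_eq_intros has_field_derivative_norm_squared [OF deriv [OF that]] refl)+
        (simp add: algebra_simps)
    have I_deriv: "(I has_field_derivative exp (- l * s) * \<delta> s) (at s within {0..T})"
      if "s \<in> {0..T}" for s
      unfolding I_def
      by (intro integral_has_real_derivative continuous_intros \<delta> that)
    \<comment> \<open>Integrating the differential inequality for \<open>sqrt (N s)\<close> amounts
      to showing that \<open>D\<close> is nonincreasing.\<close>
    define D where "D s = sqrt (N s) - I s" for s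
    have D_deriv: "(D has_field_derivative
        N' s / (2 * sqrt (N s)) - exp (- l * s) * \<delta> s) (at s within {0..T})"
      if "s \<in> {0..T}" for s
      unfolding D_def
      by (rule derivative_eq_intros DERIV_chain2 [OF DERIV_real_sqrt [OF N_pos] N_deriv [OF that]]
          I_deriv [OF that])+ (simp add: field_simps)
    have "N' s / (2 * sqrt (N s)) \<le> exp (- l * s) * \<delta> s" if "s \<in> {0..T}" for s
    proof -
      have "N' s \<le> 2 * exp (- 2 * l * s) * (norm (e s) * \<delta> s)"
        unfolding N'_def using le [OF that] by (intro mult_left_mono) auto
      \<comment> \<open>One factor \<open>exp (- l * s)\<close> goes to \<open>\<delta>\<close>, the
        other to the norm; the weighted norm is then at most \<open>sqrt (N s)\<close>, which
        cancels in the quotient.\<close>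
      also have "\<dots> = 2 * (exp (- l * s) * \<delta> s) * (exp (- l * s) * norm (e s))"
        using exp_add [of "- l * s" "- l * s"] by (simp add: mult.assoc)
      also have "\<dots> \<le> 2 * (exp (- l * s) * \<delta> s) * sqrt (N s)"
        using \<delta>(2) [OF that] by (intro mult_left_mono real_le_rsqrt) (auto simp: N_def)
      finally show ?thesis
        using N_pos [of s] by (simp add: field_simps)
    qed
    then have D'_le: "N' s / (2 * sqrt (N s)) - exp (- l * s) * \<delta> s \<le> 0" if "s \<in> {0..T}" for s
      using that by simp
    have "D t \<le> D 0"
    proof (rule DERIV_nonpos_imp_decreasing_open [where f = D])
      \<comment> \<open>Strictly between \<open>0\<close> and \<open>t\<close> the derivative within
        \<open>{0..T}\<close> is two-sided; at the endpoints continuity suffices.\<close>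
      show "\<exists>m. (D has_field_derivative m) (at s) \<and> m \<le> 0" if "0 < s" "s < t" for s
        using D_deriv [of s] D'_le [of s] that t
        by (metis at_within_Icc_at atLeastAtMost_iff less_eq_real_def order_less_le_trans)
      have "continuous_on {0..T} D"
        using D_deriv by (rule DERIV_continuous_on)
      then show "continuous_on {0..t} D"
        by (rule continuous_on_subset) (use t in auto)
    qed (use t in auto)
    \<comment> \<open>Both sides of \<open>D t \<le> D 0\<close> are freed from the regularization,
      at the cost of one \<eta> at time \<open>0\<close>, where \<open>I\<close> vanishes.\<close>
    moreover have "exp (- l * t) * norm (e t) \<le> sqrt (N t)"
      by (rule real_le_rsqrt) (simp add: N_def)
    moreover have "sqrt (N 0) \<le> norm (e 0) + \<eta>"
      using that sqrt_sum_squares_le_sum [of "norm (e 0)" \<eta>] by (simp add: N_def)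
    ultimately show ?thesis
      by (simp add: D_def I_def)
  qed
  have "exp (- l * t) * norm (e t) \<le> norm (e 0) + I t"
    by (rule field_le_epsilon) (rule bound)
  \<comment> \<open>Undo the weight: \<open>exp (l * t)\<close> moves under the integral and
    produces the kernel \<open>exp (l * (t - s))\<close>.\<close>
  then have "exp (l * t) * (exp (- l * t) * norm (e t)) \<le> exp (l * t) * (norm (e 0) + I t)"
    by (rule mult_left_mono) simp
  then have "norm (e t) \<le> exp (l * t) * norm (e 0) + exp (l * t) * I t"
    by (simp add: exp_minus field_simps)
  also have "exp (l * t) * I t = integral {0..t} (\<lambda>s. exp (l * (t - s)) * \<delta> s)"
    unfolding I_def integral_mult_right [symmetric] mult.assoc [symmetric] exp_add [symmetric]
    by (simp add: right_diff_distrib)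
  finally show ?thesis .
qed

end

theorem proposition3p1:
  fixes scale\<^sub>H :: "'k::{real_normed_field, real_inner} \<Rightarrow> 'h::banach \<Rightarrow> 'h"
    and ip\<^sub>H :: "'h \<Rightarrow> 'h \<Rightarrow> 'k"
    and scale\<^sub>Q :: "'l::{real_normed_field, real_inner} \<Rightarrow> 'q::real_normed_vector \<Rightarrow> 'q"
    and ip\<^sub>Q :: "'q \<Rightarrow> 'q \<Rightarrow> 'l"
    and \<Phi> :: "'q \<Rightarrow> 'h" and f :: "'h \<Rightarrow> 'h"
    and \<epsilon> :: "real \<Rightarrow> real" and l T :: real
    and \<theta> \<theta>' :: "real \<Rightarrow> 'q" and u y :: "real \<Rightarrow> 'h"
  assumes "hilbert_space scale\<^sub>H ip\<^sub>H"
    and "fin_dim_inner_product_space scale\<^sub>Q ip\<^sub>Q"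
    and "twice_continuously_differentiable \<Phi>"
    and "continuous_on {0..T} \<epsilon>"
    and "\<And>t. t \<in> {0..T} \<Longrightarrow> \<epsilon> t > 0"
    and "continuous_on UNIV f"
    and "\<And>v w. scalar_Re (ip\<^sub>H (v - w) (f v - f w)) \<le> l * (norm (v - w))\<^sup>2"
    and "\<And>t. t \<in> {0..T} \<Longrightarrow> (y has_vector_derivative f (y t)) (at t within {0..T})"
    and "regularized_parametric_approximation \<Phi> f \<epsilon> T \<theta> \<theta>' u"
  shows "\<forall>t\<in>{0..T}. norm (u t - y t) \<le> exp (l * t) * norm (u 0 - y 0)
    + integral {0..t} (\<lambda>s. exp (l * (t - s)) * defect_size \<Phi> f \<epsilon> \<theta> \<theta>' s)"
proof
  fix t assume t: "t \<in> {0..T}"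
  interpret hilbert_space scale\<^sub>H ip\<^sub>H
    by fact
  obtain \<Phi>' :: "'q \<Rightarrow> 'q \<Rightarrow>\<^sub>L 'h" and \<Phi>'' where
    \<Phi>': "\<And>q. (\<Phi> has_derivative blinfun_apply (\<Phi>' q)) (at q)" and
    \<Phi>'': "\<And>q. (\<Phi>' has_derivative blinfun_apply (\<Phi>'' q)) (at q)"
    using assms(3) unfolding twice_continuously_differentiable_def by blast
  have frechet: "frechet_derivative \<Phi> (at q) = blinfun_apply (\<Phi>' q)" for q
    by (metis \<Phi>' frechet_derivative_at)
  have \<theta>'_cont: "continuous_on {0..T} \<theta>'"
    and \<theta>_deriv: "\<And>s. s \<in> {0..T} \<Longrightarrow> (\<theta> has_vector_derivative \<theta>' s) (at s within {0..T})"
    and u: "\<And>s. s \<in> {0..T} \<Longrightarrow> u s = \<Phi> (\<theta> s)"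
    using assms(9) unfolding regularized_parametric_approximation_def by blast+
  have \<theta>_cont: "continuous_on {0..T} \<theta>"
    unfolding continuous_on_eq_continuous_within
    using \<theta>_deriv has_vector_derivative_continuous by blast
  have \<Phi>_cont: "continuous_on UNIV \<Phi>"
    by (rule has_derivative_continuous_on) (rule \<Phi>')
  have \<Phi>'_cont: "continuous_on UNIV \<Phi>'"
    by (rule has_derivative_continuous_on) (rule \<Phi>'')
  define \<delta> where "\<delta> = defect_size \<Phi> f \<epsilon> \<theta> \<theta>'"
  \<comment> \<open>The residual of the differential equation along \<open>u\<close>: the derivative
    of \<open>u\<close> is \<open>f (u s) + d s\<close>.\<close>
  define d where "d s = \<Phi>' (\<theta> s) (\<theta>' s) - f (\<Phi> (\<theta> s))" for s
  have \<delta>_eq: "\<delta> = (\<lambda>s. sqrt ((norm (d s))\<^sup>2 + (\<epsilon> s)\<^sup>2 * (norm (\<theta>' s))\<^sup>2))"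
    by (simp add: fun_eq_iff \<delta>_def d_def defect_size_def least_squares_functional_def frechet)
  \<comment> \<open>Continuity of \<delta> makes the integral in the bound differentiable in its
    upper limit.\<close>
  have \<delta>_cont: "continuous_on {0..T} \<delta>"
    unfolding \<delta>_eq d_def
    by (intro continuous_intros \<theta>'_cont assms(4)
        continuous_on_compose2 [OF \<Phi>'_cont \<theta>_cont]
        continuous_on_compose2 [OF assms(6) continuous_on_compose2 [OF \<Phi>_cont \<theta>_cont]]) auto
  \<comment> \<open>The regularization term in \<open>(\<delta> s)\<^sup>2\<close> is
    nonnegative.\<close>
  have d_le: "norm (d s) \<le> \<delta> s" for s
    unfolding \<delta>_eq by (rule real_le_rsqrt) simp
  have u_deriv: "(u has_vector_derivative \<Phi>' (\<theta> s) (\<theta>' s)) (at s within {0..T})"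
    if "s \<in> {0..T}" for s
  proof -
    have "((\<Phi> \<circ> \<theta>) has_derivative blinfun_apply (\<Phi>' (\<theta> s)) \<circ> (\<lambda>h. h *\<^sub>R \<theta>' s))
        (at s within {0..T})"
      using \<theta>_deriv [OF that, unfolded has_vector_derivative_def] \<Phi>'
      by (rule diff_chain_within [OF _ has_derivative_at_withinI])
    then have "((\<lambda>s. \<Phi> (\<theta> s)) has_vector_derivative \<Phi>' (\<theta> s) (\<theta>' s)) (at s within {0..T})"
      by (simp add: has_vector_derivative_def o_def blinfun.scaleR_right)
    \<comment> \<open>\<open>u\<close> is prescribed only on \<open>{0..T}\<close>, so the
      derivative is transferred within that interval.\<close>
    then show ?thesis
      by (rule has_vector_derivative_transform [OF that, rotated]) (simp add: u)
  qed
  have "norm (u t - y t) \<le> exp (l * t) * norm (u 0 - y 0)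
      + integral {0..t} (\<lambda>s. exp (l * (t - s)) * \<delta> s)"
  proof (rule norm_gronwall [where e' = "\<lambda>s. \<Phi>' (\<theta> s) (\<theta>' s) - f (y s)"])
    fix s assume s: "s \<in> {0..T}"
    show "((\<lambda>s. u s - y s) has_vector_derivative \<Phi>' (\<theta> s) (\<theta>' s) - f (y s))
        (at s within {0..T})"
      by (intro has_vector_derivative_diff u_deriv assms(8) s)
    \<comment> \<open>Inserting \<open>f (u s)\<close> separates a difference of \<open>f\<close>,
      controlled by the one-sided Lipschitz condition, from the residual, controlled by
      Cauchy-Schwarz.\<close>
    have "re_ip (u s - y s) (\<Phi>' (\<theta> s) (\<theta>' s) - f (y s))
        = re_ip (u s - y s) (f (u s) - f (y s)) + re_ip (u s - y s) (d s)"
      by (simp add: d_def u [OF s] flip: re_ip_add_right)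
    also have "\<dots> \<le> l * (norm (u s - y s))\<^sup>2 + norm (u s - y s) * norm (d s)"
      using assms(7) [of "u s" "y s"] re_ip_Cauchy_Schwarz [of "u s - y s" "d s"]
      by (simp add: re_ip_def)
    also have "\<dots> \<le> l * (norm (u s - y s))\<^sup>2 + norm (u s - y s) * \<delta> s"
      by (intro add_left_mono mult_left_mono d_le) simp
    finally show "re_ip (u s - y s) (\<Phi>' (\<theta> s) (\<theta>' s) - f (y s))
        \<le> l * (norm (u s - y s))\<^sup>2 + norm (u s - y s) * \<delta> s" .
    show "0 \<le> \<delta> s"
      using d_le [of s] norm_ge_zero order_trans by blast
  qed (fact \<delta>_cont t)+
  then show "norm (u t - y t) \<le> exp (l * t) * norm (u 0 - y 0)
      + integral {0..t} (\<lambda>s. exp (l * (t - s)) * defect_size \<Phi> f \<epsilon> \<theta> \<theta>' s)"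
    unfolding \<delta>_def .
qed

end
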